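(* Let $f\in\mathbb{R}[\mathbf{x}]$ with $d_0=\deg f$, and let $$\mathbf{K}=\{\mathbf{x}\in\mathbb{R}^n:\ g_j(\mathbf{x})\ge0,\ j=1,\dots,m+n\},\qquad g_{m+i}(\mathbf{x})=1-x_i^2,\quad i=1,\dots,n,$$ where $g_1,\dots,g_m\in\mathbb{R}[\mathbf{x}]$, and $0\in\mathbf{K}$. Assume that $\mathbf{K}$ has a nonempty interior. Let $d\in\mathbb{N}$ be fixed and let $\tilde f_d\in\mathbb{R}[\mathbf{x}]_{d_0}$ be an optimal solution, with optimal value $\rho_d^1$, of the inverse problem for the $\ell_1$-norm $$\mathbf{P}_d:\quad\rho_d^1:=\min_{\tilde f,\sigma_j\in\mathbb{R}[\mathbf{x}]}\Big\{\|f-\tilde f\|_1:\ \tilde f(\mathbf{x})-\tilde f(0)=\sum_{j=0}^{m+n}\sigma_j(\mathbf{x})\,g_j(\mathbf{x})\ \ \forall\mathbf{x}\in\mathbb{R}^n,\ \ \tilde f\in\mathbb{R}[\mathbf{x}]_{d_0},\ \sigma_j\in\Sigma[\mathbf{x}]_{d-v_j},\ j=0,1,\dots,m+n\Big\}.$$ Then: (i) $\tilde f_d$ is of the form $$\tilde f_d(\mathbf{x})=\begin{cases} f(\mathbf{x})+\mathbf{b}^T\mathbf{x}&\text{if }d_0=1,\\ f(\mathbf{x})+\mathbf{b}^T\mathbf{x}+\sum_{i=1}^n\lambda_i^*\,x_i^2&\text{if }d_0>1,\end{cases}$$ for some vector $\mathbf{b}\in\mathbb{R}^n$ and some nonnegative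 vector $\lambda^*\in\mathbb{R}^n$, optimal solution of the semidefinite program $$\rho_d^1=\min_{\lambda,\mathbf{b}}\Big\{\|\mathbf{b}\|_1+\sum_{i=1}^n\lambda_i:\ f-f(0)+\mathbf{b}^T\mathbf{x}+\sum_{i=1}^n\lambda_i\,x_i^2\in Q_d(g),\ \lambda\ge0\Big\}.$$ (ii) The vector $\mathbf{b}$ is of the form $-\nabla f(0)+\sum_{j\in J(0)}\theta_j\,\nabla g_j(0)$ for some nonnegative scalars $(\theta_j)$, where $j\in J(0)$ if and only if $g_j(0)=0$.
   Context: $\mathbb{R}[\mathbf{x}]$ is the ring of real polynomials in $\mathbf{x}=(x_1,\dots,x_n)$, $\mathbb{R}[\mathbf{x}]_r$ its subset of polynomials of degree at most $r$, and $\Sigma[\mathbf{x}]_r$ the set of sums of squares polynomials of degree at most $2r$. With $g_0$ the constant polynomial $1$ and $v_j=\lceil(\deg g_j)/2\rceil$, $$Q_d(g)=\Big\{\sum_{j=0}^{m+n}\sigma_j\,g_j:\ \sigma_j\in\Sigma[\mathbf{x}]_{d-v_j},\ j=0,\dots,m+n\Big\}.$$ For a polynomial $h=\sum_\alpha h_\alpha\mathbf{x}^\alpha$, $\|h\|_1=\sum_\alpha|h_\alpha|$; for a vector, $\|\mathbf{b}\|_1=\sum_i|b_i|$. The problem $\mathbf{P}_d$ is the inverse optimization problem associated with minimizing $f$ over $\mathbf{K}$ and a given feasible point $\mathbf{y}\in\mathbf{K}$, which is taken, after the change of variable $\mathbf{x}'=\mathbf{x}-\mathbf{y}$, to be $\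mathbf{y}=0$.
   Formalization: Proved with d_0 ≤ 2d assumed; for d_0>1 only: f+b^Tx+Σλ*_i x_i^2 is an optimal solution of P_d agreeing with the given f̃_d in degrees ≤1 (minimizers are not unique); for d_0=1 the semidefinite program is taken with λ=0. The literal claims fail otherwise. *)

theory Defs
  imports "HOL-Analysis.Analysis" "HOL-Library.Poly_Mapping"
begin

text \<open>Real polynomials in variables indexed by a finite type, as the monoid algebra of the
  exponent vectors; ring operations are those of \<^theory>\<open>HOL-Library.Poly_Mapping\<close>.\<close>

type_synonym 'n rpoly = "('n \<Rightarrow>\<^sub>0 nat) \<Rightarrow>\<^sub>0 real"

definition Const :: "real \<Rightarrow> 'n rpoly" where
  "Const c = Poly_Mapping.single 0 c"

definition Var :: "'n \<Rightarrow> 'n rpoly" where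
  "Var i = Poly_Mapping.single (Poly_Mapping.single i 1) 1"

definition peval :: "'n::finite rpoly \<Rightarrow> real ^ 'n \<Rightarrow> real" where
  "peval p x = (\<Sum>\<alpha>\<in>Poly_Mapping.keys p.
     Poly_Mapping.lookup p \<alpha> * (\<Prod>i\<in>UNIV. (x $ i) ^ Poly_Mapping.lookup \<alpha> i))"

definition expdeg :: "('n::finite \<Rightarrow>\<^sub>0 nat) \<Rightarrow> nat" where
  "expdeg \<alpha> = (\<Sum>i\<in>UNIV. Poly_Mapping.lookup \<alpha> i)"

text \<open>The zero polynomial gets degree 0.\<close>

definition pdeg :: "'n::finite rpoly \<Rightarrow> nat" where
  "pdeg p = Max (insert 0 (expdeg ` Poly_Mapping.keys p))"

definition l1norm :: "'n rpoly \<Rightarrow> real" where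
  "l1norm p = (\<Sum>\<alpha>\<in>Poly_Mapping.keys p. \<bar>Poly_Mapping.lookup p \<alpha>\<bar>)"

definition vec_l1norm :: "real ^ 'n::finite \<Rightarrow> real" where
  "vec_l1norm b = (\<Sum>i\<in>UNIV. \<bar>b $ i\<bar>)"

definition grad :: "(real ^ 'n::finite \<Rightarrow> real) \<Rightarrow> real ^ 'n \<Rightarrow> real ^ 'n" where
  "grad h x = (THE D. GDERIV h x :> D)"

definition linear_form :: "real ^ 'n::finite \<Rightarrow> 'n rpoly" where
  "linear_form b = (\<Sum>i\<in>UNIV. Const (b $ i) * Var i)"

definition diag_form :: "real ^ 'n::finite \<Rightarrow> 'n rpoly" where
  "diag_form c = (\<Sum>i\<in>UNIV. Const (c $ i) * Var i ^ 2)"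

definition is_sos :: "'n rpoly \<Rightarrow> bool" where
  "is_sos s \<longleftrightarrow> (\<exists>(N::nat) p. s = (\<Sum>k<N. p k ^ 2))"

text \<open>Sums of squares of degree at most \<open>2 * r\<close>. The bound is an integer because it is used with
  \<open>r = d - v\<^sub>j\<close>; for negative \<open>r\<close> only the zero polynomial remains.\<close>

definition SOS :: "int \<Rightarrow> ('n::finite rpoly) set" where
  "SOS r = {s. is_sos s \<and> (s = 0 \<or> int (pdeg s) \<le> 2 * r)}"

text \<open>The index \<open>Inl 0\<close> stands for the constant polynomial 1, \<open>Inl j\<close> with \<open>1 \<le> j \<le> m\<close> for
  \<open>g\<^sub>j\<close>, and \<open>Inr i\<close> for the box constraint \<open>g\<^sub>m\<^sub>+\<^sub>i\<close> of the variable \<open>i\<close>.\<close>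

fun con :: "(nat \<Rightarrow> 'n rpoly) \<Rightarrow> nat + 'n \<Rightarrow> 'n rpoly" where
  "con g (Inl j) = (if j = 0 then 1 else g j)"
| "con g (Inr i) = 1 - Var i ^ 2"

abbreviation con_idx :: "nat \<Rightarrow> (nat + 'n) set" where
  "con_idx m \<equiv> {1..m} <+> UNIV"

abbreviation con_idx0 :: "nat \<Rightarrow> (nat + 'n) set" where
  "con_idx0 m \<equiv> {0..m} <+> UNIV"

definition feas_set :: "nat \<Rightarrow> (nat \<Rightarrow> 'n::finite rpoly) \<Rightarrow> (real ^ 'n) set" where
  "feas_set m g = {x. \<forall>j\<in>con_idx m. 0 \<le> peval (con g j) x}"

definition active :: "nat \<Rightarrow> (nat \<Rightarrow> 'n::finite rpoly) \<Rightarrow> real ^ 'n \<Rightarrow> (nat + 'n) set" where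
  "active m g x = {j\<in>con_idx m. peval (con g j) x = 0}"

definition half_deg :: "'n::finite rpoly \<Rightarrow> int" where
  "half_deg p = \<lceil>real (pdeg p) / 2\<rceil>"

definition Qmod :: "nat \<Rightarrow> nat \<Rightarrow> (nat \<Rightarrow> 'n::finite rpoly) \<Rightarrow> ('n rpoly) set" where
  "Qmod d m g = {\<Sum>j\<in>con_idx0 m. \<sigma> j * con g j | \<sigma>.
     \<forall>j\<in>con_idx0 m. \<sigma> j \<in> SOS (int d - half_deg (con g j))}"

definition inv_feasible ::
  "nat \<Rightarrow> nat \<Rightarrow> (nat \<Rightarrow> 'n::finite rpoly) \<Rightarrow> 'n rpoly \<Rightarrow> 'n rpoly \<Rightarrow> bool" where
  "inv_feasible d m g f h \<longleftrightarrow> pdeg h \<le> pdeg f \<and>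
     (\<exists>\<sigma>. (\<forall>j\<in>con_idx0 m. \<sigma> j \<in> SOS (int d - half_deg (con g j))) \<and>
          (\<forall>x. peval h x - peval h 0 = (\<Sum>j\<in>con_idx0 m. peval (\<sigma> j) x * peval (con g j) x)))"

definition inv_optimal ::
  "nat \<Rightarrow> nat \<Rightarrow> (nat \<Rightarrow> 'n::finite rpoly) \<Rightarrow> 'n rpoly \<Rightarrow> 'n rpoly \<Rightarrow> bool" where
  "inv_optimal d m g f = is_arg_min (\<lambda>h. l1norm (f - h)) (inv_feasible d m g f)"

text \<open>The semidefinite program in \<open>(b, \<lambda>)\<close>. When \<open>f\<close> has degree 1 the quadratic terms are absent,
  because perturbed polynomials must not exceed the degree of \<open>f\<close>. Dropping this clause would
  make the program a strict relaxation: for the single constraint \<open>10 y + x\<^sup>2 \<ge> 0\<close> (plus the box),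
  \<open>f = 10 y\<close> and \<open>d = 1\<close>, the value is 10 with it and at most 1 without it.\<close>

definition sdp_feasible ::
  "nat \<Rightarrow> nat \<Rightarrow> (nat \<Rightarrow> 'n::finite rpoly) \<Rightarrow> 'n rpoly \<Rightarrow> (real ^ 'n) \<times> (real ^ 'n) \<Rightarrow> bool" where
  "sdp_feasible d m g f = (\<lambda>(b, lam). (\<forall>i. 0 \<le> lam $ i) \<and> (pdeg f = 1 \<longrightarrow> lam = 0) \<and>
     f - Const (peval f 0) + linear_form b + diag_form lam \<in> Qmod d m g)"

definition sdp_objective :: "(real ^ 'n::finite) \<times> (real ^ 'n) \<Rightarrow> real" where
  "sdp_objective = (\<lambda>(b, lam). vec_l1norm b + (\<Sum>i\<in>UNIV. lam $ i))"

definition sdp_optimal ::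
  "nat \<Rightarrow> nat \<Rightarrow> (nat \<Rightarrow> 'n::finite rpoly) \<Rightarrow> 'n rpoly \<Rightarrow> (real ^ 'n) \<times> (real ^ 'n) \<Rightarrow> bool" where
  "sdp_optimal d m g f = is_arg_min sdp_objective (sdp_feasible d m g f)"

end

theory Submission
  imports Defs
begin

text \<open>
  Write \<open>p = ft - f\<close> for the perturbation. Feasibility only depends on the nonconstant part, and a
  monomial of degree at least 2 in \<open>p\<close> can be traded for squares of variables at no cost. Indeed, if
  \<open>x\<^sup>\<alpha>\<close> has degree between 2 and \<open>2 d\<close>, split it as \<open>x\<^sup>\<alpha> = x\<^sup>\<beta> x\<^sup>\<gamma>\<close> with both factors nonconstant
  of degree at most \<open>d\<close>, and let \<open>x\<^sub>i\<close> divide \<open>x\<^sup>\<beta>\<close> and \<open>x\<^sub>k\<close> divide \<open>x\<^sup>\<gamma>\<close>. Then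
  \<open>(x\<^sup>\<beta>)\<^sup>2 / 2 + (x\<^sup>\<gamma>)\<^sup>2 / 2 \<plusminus> x\<^sup>\<alpha>\<close> is half a square, and \<open>x\<^sub>i\<^sup>2 - (x\<^sup>\<beta>)\<^sup>2\<close> lies in the truncated quadratic
  module because the constraints \<open>1 - x\<^sub>l\<^sup>2\<close> allow one variable after the other to be removed from
  \<open>x\<^sup>\<beta>\<close>. Hence \<open>\<bar>c\<bar> (x\<^sub>i\<^sup>2 + x\<^sub>k\<^sup>2) / 2 - c x\<^sup>\<alpha>\<close> is in the module: replacing the term \<open>c x\<^sup>\<alpha>\<close> by the squares
  keeps the certificate and spends exactly \<open>\<bar>c\<bar>\<close> of the norm
  (lemma \<open>diag_form_minus_term_in_Qmod\<close>).

  Doing this for all terms of degree at least 2 and dropping the constant term gives a point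
  \<open>(b, \<lambda>)\<close> of the semidefinite program whose value is the norm of \<open>p\<close> minus \<open>\<bar>p 0\<bar>\<close>
  (lemma \<open>sdp_feasible_of_inv_feasible\<close>), where \<open>b\<close> holds the linear coefficients of \<open>p\<close>.
  Conversely every point of the program yields a feasible polynomial whose distance to \<open>f\<close> is at most
  the objective (lemma \<open>l1norm_le_sdp_objective\<close>). So the constant term of \<open>p\<close> vanishes, both optimal
  values agree, and the sparse polynomial is optimal.

  The formula for \<open>b\<close> is the first-order condition contained in the certificate. At the origin every
  product \<open>\<sigma>\<^sub>j g\<^sub>j\<close> is nonnegative and they sum to zero, so each vanishes. Where \<open>g\<^sub>j\<close> is positive, \<open>\<sigma>\<^sub>j\<close> has
  a minimum at the origin, so that the gradient of the product is zero; where \<open>g\<^sub>j\<close> is active, this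
  gradient is \<open>\<sigma>\<^sub>j(0)\<close> times that of \<open>g\<^sub>j\<close> (lemma \<open>grad_Qmod_at_zero\<close>).
\<close>

abbreviation coef :: "'n rpoly \<Rightarrow> ('n \<Rightarrow>\<^sub>0 nat) \<Rightarrow> real" where
  "coef \<equiv> Poly_Mapping.lookup"

abbreviation mterm :: "('n \<Rightarrow>\<^sub>0 nat) \<Rightarrow> real \<Rightarrow> 'n rpoly" where
  "mterm \<equiv> Poly_Mapping.single"

abbreviation unit_exp :: "'n \<Rightarrow> ('n \<Rightarrow>\<^sub>0 nat)" where
  "unit_exp i \<equiv> Poly_Mapping.single i 1"

definition mon_eval :: "('n::finite \<Rightarrow>\<^sub>0 nat) \<Rightarrow> real ^ 'n \<Rightarrow> real" where
  "mon_eval \<alpha> x = (\<Prod>i\<in>UNIV. (x $ i) ^ Poly_Mapping.lookup \<alpha> i)"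

section \<open>Evaluation of polynomials\<close>

lemma poly_eq_sum_terms:
  assumes "finite A" "Poly_Mapping.keys p \<subseteq> A"
  shows "p = (\<Sum>\<alpha>\<in>A. mterm \<alpha> (coef p \<alpha>))"
proof (rule poly_mapping_eqI)
  fix \<beta>
  have "coef (\<Sum>\<alpha>\<in>A. mterm \<alpha> (coef p \<alpha>)) \<beta> = (\<Sum>\<alpha>\<in>A. if \<alpha> = \<beta> then coef p \<alpha> else 0)"
    by (simp add: lookup_sum lookup_single when_def)
  also have "\<dots> = coef p \<beta>"
    using assms by (auto simp: in_keys_iff)
  finally show "coef p \<beta> = coef (\<Sum>\<alpha>\<in>A. mterm \<alpha> (coef p \<alpha>)) \<beta>" by simp
qed

lemma peval_superset:
  assumes "finite A" "Poly_Mapping.keys p \<subseteq> A"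
  shows "peval p x = (\<Sum>\<alpha>\<in>A. coef p \<alpha> * mon_eval \<alpha> x)"
  unfolding peval_def mon_eval_def
  by (rule sum.mono_neutral_left) (use assms in \<open>auto simp: in_keys_iff\<close>)

lemma peval_term [simp]: "peval (mterm \<alpha> c) x = c * mon_eval \<alpha> x"
  by (subst peval_superset[of "{\<alpha>}"]) auto

lemma peval_zero [simp]: "peval 0 x = 0"
  by (simp add: peval_def)

lemma peval_add [simp]: "peval (p + q) x = peval p x + peval q x"
  using keys_add[of p q]
  by (simp add: peval_superset[of "Poly_Mapping.keys p \<union> Poly_Mapping.keys q"] lookup_add
      distrib_right sum.distrib)

lemma peval_uminus [simp]: "peval (- p) x = - peval p x"
  by (simp add: peval_superset[of "Poly_Mapping.keys p"] sum_negf)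

lemma peval_diff [simp]: "peval (p - q) x = peval p x - peval q x"
  using peval_add[of p "- q" x] by simp

lemma peval_sum [simp]: "peval (\<Sum>k\<in>A. p k) x = (\<Sum>k\<in>A. peval (p k) x)"
  by (induction A rule: infinite_finite_induct) auto

lemma mon_eval_zero [simp]: "mon_eval 0 x = 1"
  by (simp add: mon_eval_def)

lemma mon_eval_add: "mon_eval (\<alpha> + \<beta>) x = mon_eval \<alpha> x * mon_eval \<beta> x"
  by (simp add: mon_eval_def lookup_add power_add prod.distrib)

lemma mon_eval_single [simp]: "mon_eval (Poly_Mapping.single i k) x = (x $ i) ^ k"
proof -
  have "mon_eval (Poly_Mapping.single i k) x = (\<Prod>j\<in>UNIV. if j = i then (x $ i) ^ k else 1)"
    unfolding mon_eval_def by (rule prod.cong) (auto simp: lookup_single when_def)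
  then show ?thesis by simp
qed

lemma peval_one [simp]: "peval 1 x = 1"
  using peval_term[of 0 1 x] by simp

lemma peval_Const [simp]: "peval (Const c) x = c"
  by (simp add: Const_def)

lemma peval_mult [simp]: "peval (p * q) x = peval p x * peval q x"
proof -
  let ?P = "Poly_Mapping.keys p" and ?Q = "Poly_Mapping.keys q"
  have "p * q = (\<Sum>\<alpha>\<in>?P. mterm \<alpha> (coef p \<alpha>)) * (\<Sum>\<beta>\<in>?Q. mterm \<beta> (coef q \<beta>))"
    using poly_eq_sum_terms[of ?P p] poly_eq_sum_terms[of ?Q q] by simp
  also have "\<dots> = (\<Sum>\<alpha>\<in>?P. \<Sum>\<beta>\<in>?Q. mterm (\<alpha> + \<beta>) (coef p \<alpha> * coef q \<beta>))"
    by (simp add: sum_product mult_single)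
  finally have "peval (p * q) x
      = (\<Sum>\<alpha>\<in>?P. \<Sum>\<beta>\<in>?Q. (coef p \<alpha> * coef q \<beta>) * mon_eval (\<alpha> + \<beta>) x)"
    by simp
  also have "\<dots> = (\<Sum>\<alpha>\<in>?P. \<Sum>\<beta>\<in>?Q. (coef p \<alpha> * mon_eval \<alpha> x) * (coef q \<beta> * mon_eval \<beta> x))"
    by (simp add: mon_eval_add mult_ac)
  also have "\<dots> = peval p x * peval q x"
    by (simp add: peval_superset[of ?P p] peval_superset[of ?Q q] sum_product)
  finally show ?thesis .
qed

lemma peval_power [simp]: "peval (p ^ k) x = peval p x ^ k"
  by (induction k) auto

lemma peval_at_zero:
  fixes p :: "'n::finite rpoly"
  shows "peval p 0 = coef p 0"
proof -
  have m: "mon_eval \<alpha> (0 :: real ^ 'n) = (if \<alpha> = 0 then 1 else 0)" for \<alpha> :: "'n \<Rightarrow>\<^sub>0 nat"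
  proof (cases "\<alpha> = 0")
    case False
    then obtain i where "Poly_Mapping.lookup \<alpha> i \<noteq> 0"
      by (metis poly_mapping_eqI lookup_zero)
    then show ?thesis
      using False by (auto simp: mon_eval_def intro!: prod_zero)
  qed simp
  show ?thesis
    by (auto simp: peval_superset[of "Poly_Mapping.keys p" p] m if_distrib in_keys_iff cong: if_cong)
qed

text \<open>Fix the exponents of the variables one at a time. If the terms of \<open>p\<close> that agree with
  \<open>\<beta>\<close> on the variables in \<open>S\<close>, stripped of these variables, sum to the zero function, then viewing that
  sum as a polynomial in one further variable shows the same for \<open>S\<close> enlarged by it. Once all variables
  are fixed only the coefficient of \<open>\<beta>\<close> is left.\<close>

lemma peval_eq_zero_imp_zero:
  fixes p :: "'n::finite rpoly"
  assumes "\<And>x. peval p x = 0"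
  shows "p = 0"
proof (rule poly_mapping_eqI)
  fix \<beta> :: "'n \<Rightarrow>\<^sub>0 nat"
  let ?K = "Poly_Mapping.keys p"
  let ?slice = "\<lambda>S. {\<alpha>\<in>?K. \<forall>i\<in>S. Poly_Mapping.lookup \<alpha> i = Poly_Mapping.lookup \<beta> i}"
  have slices: "\<forall>x. (\<Sum>\<alpha>\<in>?slice S. coef p \<alpha> * (\<Prod>i\<in>- S. (x $ i) ^ Poly_Mapping.lookup \<alpha> i)) = 0"
    if "finite S" for S
    using that
  proof induction
    case empty
    then show ?case using assms by (simp add: peval_def)
  next
    case (insert k S)
    show ?case
    proof
      fix x :: "real ^ 'n"
      define N where "N = Max (insert (Poly_Mapping.lookup \<beta> k) ((\<lambda>\<alpha>. Poly_Mapping.lookup \<alpha> k) ` ?K))"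
      define c where "c e = (\<Sum>\<alpha>\<in>{\<alpha>\<in>?slice S. Poly_Mapping.lookup \<alpha> k = e}.
          coef p \<alpha> * (\<Prod>i\<in>- insert k S. (x $ i) ^ Poly_Mapping.lookup \<alpha> i))" for e
      have "(\<Sum>e\<le>N. c e * t ^ e) = 0" for t
      proof -
        \<comment> \<open>Set the variable \<open>k\<close> to \<open>t\<close>, keep the others, and sort by the exponent of \<open>k\<close>.\<close>
        define y where "y = (\<chi> i. if i = k then t else x $ i)"
        have prod_y: "(\<Prod>i\<in>- S. (y $ i) ^ Poly_Mapping.lookup \<alpha> i)
            = t ^ Poly_Mapping.lookup \<alpha> k * (\<Prod>i\<in>- insert k S. (x $ i) ^ Poly_Mapping.lookup \<alpha> i)" for \<alpha>
        proof -
          have eq: "- S = insert k (- insert k S)" using insert.hyps by auto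
          have "(\<Prod>i\<in>- S. (y $ i) ^ Poly_Mapping.lookup \<alpha> i)
              = (y $ k) ^ Poly_Mapping.lookup \<alpha> k * (\<Prod>i\<in>- insert k S. (y $ i) ^ Poly_Mapping.lookup \<alpha> i)"
            by (subst eq, subst prod.insert) auto
          also have "(\<Prod>i\<in>- insert k S. (y $ i) ^ Poly_Mapping.lookup \<alpha> i)
              = (\<Prod>i\<in>- insert k S. (x $ i) ^ Poly_Mapping.lookup \<alpha> i)"
            by (rule prod.cong) (auto simp: y_def)
          finally show ?thesis by (simp add: y_def)
        qed
        have bound: "(\<lambda>\<alpha>. Poly_Mapping.lookup \<alpha> k) ` ?slice S \<subseteq> {..N}"
          by (auto simp: N_def intro!: Max_ge)
        have "0 = (\<Sum>\<alpha>\<in>?slice S. coef p \<alpha> * (\<Prod>i\<in>- S. (y $ i) ^ Poly_Mapping.lookup \<alpha> i))"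
          using insert.IH by simp
        also have "\<dots> = (\<Sum>e\<le>N. \<Sum>\<alpha>\<in>{\<alpha>\<in>?slice S. Poly_Mapping.lookup \<alpha> k = e}.
            coef p \<alpha> * (\<Prod>i\<in>- S. (y $ i) ^ Poly_Mapping.lookup \<alpha> i))"
          by (rule sum.group[symmetric]) (use bound in auto)
        also have "\<dots> = (\<Sum>e\<le>N. c e * t ^ e)"
          unfolding c_def sum_distrib_right
          by (intro sum.cong) (auto simp: prod_y mult_ac)
        finally show ?thesis by simp
      qed
      then have "\<forall>e\<le>N. c e = 0"
        using Transcendental.polyfun_eq_0[where c = c and n = N] by simp
      moreover have "Poly_Mapping.lookup \<beta> k \<le> N"
        by (auto simp: N_def intro!: Max_ge)
      ultimately have "c (Poly_Mapping.lookup \<beta> k) = 0" by simp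
      moreover have "{\<alpha>\<in>?slice S. Poly_Mapping.lookup \<alpha> k = Poly_Mapping.lookup \<beta> k} = ?slice (insert k S)"
        by auto
      ultimately show "(\<Sum>\<alpha>\<in>?slice (insert k S).
          coef p \<alpha> * (\<Prod>i\<in>- insert k S. (x $ i) ^ Poly_Mapping.lookup \<alpha> i)) = 0"
        unfolding c_def by simp
    qed
  qed
  have "?slice UNIV = {\<alpha>\<in>?K. \<alpha> = \<beta>}"
    by (auto intro: poly_mapping_eqI)
  then have "?slice UNIV = (if \<beta> \<in> ?K then {\<beta>} else {})"
    by auto
  with slices[of UNIV] show "coef p \<beta> = coef 0 \<beta>"
    by (auto simp: in_keys_iff split: if_splits)
qed

text \<open>The certificates of the inverse problem are identities of functions, those of the
  semidefinite program identities of polynomials; this is what makes them interchangeable.\<close>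

lemma peval_inject:
  assumes "\<And>x. peval p x = peval q x"
  shows "p = q"
  using peval_eq_zero_imp_zero[of "p - q"] assms by simp

section \<open>Exponents, degrees and the coefficient norm\<close>

lemma expdeg_zero [simp]: "expdeg 0 = 0"
  by (simp add: expdeg_def)

lemma expdeg_add [simp]: "expdeg (\<alpha> + \<beta>) = expdeg \<alpha> + expdeg \<beta>"
  by (simp add: expdeg_def lookup_add sum.distrib)

lemma expdeg_single [simp]: "expdeg (Poly_Mapping.single i k) = k"
proof -
  have "expdeg (Poly_Mapping.single i k) = (\<Sum>j\<in>UNIV. if j = i then k else 0)"
    unfolding expdeg_def by (rule sum.cong) (auto simp: lookup_single when_def)
  then show ?thesis by simp
qed

lemma expdeg_eq_0_iff [simp]: "expdeg \<alpha> = 0 \<longleftrightarrow> \<alpha> = 0"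
  by (auto simp: expdeg_def intro!: poly_mapping_eqI)

lemma expdeg_Suc_split:
  assumes "expdeg \<alpha> = Suc n"
  obtains k \<beta> where "\<alpha> = unit_exp k + \<beta>" "expdeg \<beta> = n"
proof -
  from assms have "\<alpha> \<noteq> 0" by auto
  then obtain k where k: "Poly_Mapping.lookup \<alpha> k \<noteq> 0"
    by (metis poly_mapping_eqI lookup_zero)
  have "\<alpha> = unit_exp k + (\<alpha> - unit_exp k)"
    by (rule poly_mapping_eqI) (use k in \<open>auto simp: lookup_add lookup_minus lookup_single when_def\<close>)
  moreover from this have "expdeg \<alpha> = Suc (expdeg (\<alpha> - unit_exp k))"
    by (metis expdeg_add expdeg_single plus_1_eq_Suc)
  ultimately show thesis using that assms by simp
qed

lemma expdeg_split:
  assumes "expdeg \<alpha> = a + b"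
  shows "\<exists>\<beta> \<gamma>. \<alpha> = \<beta> + \<gamma> \<and> expdeg \<beta> = a \<and> expdeg \<gamma> = b"
  using assms
proof (induction a arbitrary: \<alpha>)
  case 0
  then show ?case by (intro exI[of _ 0] exI[of _ \<alpha>]) simp
next
  case (Suc a)
  then obtain k \<alpha>' where \<alpha>: "\<alpha> = unit_exp k + \<alpha>'" "expdeg \<alpha>' = a + b"
    by (auto elim: expdeg_Suc_split)
  from Suc.IH[OF \<alpha>(2)] obtain \<beta> \<gamma> where "\<alpha>' = \<beta> + \<gamma>" "expdeg \<beta> = a" "expdeg \<gamma> = b"
    by blast
  then show ?case
    using \<alpha>(1) by (intro exI[of _ "unit_exp k + \<beta>"] exI[of _ \<gamma>]) (simp add: add_ac)
qed

lemma expdeg_1_iff: "expdeg \<alpha> = 1 \<longleftrightarrow> (\<exists>i. \<alpha> = unit_exp i)"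
  by (auto elim!: expdeg_Suc_split)

lemma single_Suc_inject [simp]:
  "Poly_Mapping.single i (Suc k) = Poly_Mapping.single j (Suc k) \<longleftrightarrow> i = j"
  by (metis lookup_single_eq lookup_single_not_eq nat.distinct(1))

lemma pdeg_le_iff: "pdeg p \<le> k \<longleftrightarrow> (\<forall>\<alpha>\<in>Poly_Mapping.keys p. expdeg \<alpha> \<le> k)"
  by (simp add: pdeg_def)

lemma pdeg_zero [simp]: "pdeg 0 = 0"
  by (simp add: pdeg_def)

lemma expdeg_le_pdeg: "coef p \<alpha> \<noteq> 0 \<Longrightarrow> expdeg \<alpha> \<le> pdeg p"
  using pdeg_le_iff[of p "pdeg p"] by (simp add: in_keys_iff)

lemma pdeg_add_le: "pdeg p \<le> k \<Longrightarrow> pdeg q \<le> k \<Longrightarrow> pdeg (p + q) \<le> k"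
  using keys_add[of p q] by (auto simp: pdeg_le_iff)

lemma pdeg_diff_le: "pdeg p \<le> k \<Longrightarrow> pdeg q \<le> k \<Longrightarrow> pdeg (p - q) \<le> k"
  by (auto simp: pdeg_le_iff in_keys_iff lookup_minus)

lemma pdeg_sum_le: "(\<And>k. k \<in> A \<Longrightarrow> pdeg (p k) \<le> n) \<Longrightarrow> pdeg (\<Sum>k\<in>A. p k) \<le> n"
  by (induction A rule: infinite_finite_induct) (auto simp: pdeg_add_le)

lemma pdeg_term_le: "expdeg \<alpha> \<le> k \<Longrightarrow> pdeg (mterm \<alpha> c) \<le> k"
  by (simp add: pdeg_le_iff)

lemma l1norm_superset:
  assumes "finite A" "Poly_Mapping.keys p \<subseteq> A"
  shows "l1norm p = (\<Sum>\<alpha>\<in>A. \<bar>coef p \<alpha>\<bar>)"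
  unfolding l1norm_def
  by (rule sum.mono_neutral_left) (use assms in \<open>auto simp: in_keys_iff\<close>)

lemma l1norm_zero [simp]: "l1norm 0 = 0"
  by (simp add: l1norm_def)

lemma l1norm_uminus [simp]: "l1norm (- p) = l1norm p"
  by (simp add: l1norm_def)

lemma l1norm_add_le: "l1norm (p + q) \<le> l1norm p + l1norm q"
  using keys_add[of p q]
  by (simp add: l1norm_superset[of "Poly_Mapping.keys p \<union> Poly_Mapping.keys q"] lookup_add
      sum.distrib[symmetric] sum_mono)

lemma l1norm_sum_le: "l1norm (\<Sum>k\<in>A. p k) \<le> (\<Sum>k\<in>A. l1norm (p k))"
  by (induction A rule: infinite_finite_induct) (auto intro: order_trans[OF l1norm_add_le])

lemma l1norm_term [simp]: "l1norm (mterm \<alpha> c) = \<bar>c\<bar>"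
  by (simp add: l1norm_def)

lemma Var_power2: "Var i ^ 2 = mterm (Poly_Mapping.single i 2) 1"
  by (simp add: Var_def power2_eq_square mult_single single_add[symmetric] numeral_2_eq_2)

lemma linear_form_eq: "linear_form b = (\<Sum>i\<in>UNIV. mterm (unit_exp i) (b $ i))"
  by (simp add: linear_form_def Const_def Var_def mult_single)

lemma diag_form_eq: "diag_form c = (\<Sum>i\<in>UNIV. mterm (Poly_Mapping.single i 2) (c $ i))"
  by (simp add: diag_form_def Const_def Var_power2 mult_single)

lemma linear_form_zero [simp]: "linear_form 0 = 0"
  by (simp add: linear_form_eq)

lemma diag_form_zero [simp]: "diag_form 0 = 0"
  by (simp add: diag_form_eq)

lemma diag_form_add: "diag_form (a + b) = diag_form a + diag_form b"
  by (simp add: diag_form_eq single_add sum.distrib)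

lemma diag_form_sum: "diag_form (\<Sum>k\<in>A. a k) = (\<Sum>k\<in>A. diag_form (a k))"
  by (induction A rule: infinite_finite_induct) (auto simp: diag_form_add)

lemma diag_form_axis: "diag_form (axis i c) = mterm (Poly_Mapping.single i 2) c"
proof -
  have "diag_form (axis i c) = (\<Sum>j\<in>UNIV. if j = i then mterm (Poly_Mapping.single i 2) c else 0)"
    unfolding diag_form_eq by (rule sum.cong) (auto simp: axis_def)
  then show ?thesis by simp
qed

lemma coef_linear_form_unit [simp]: "coef (linear_form b) (unit_exp i) = b $ i"
  by (simp add: linear_form_eq lookup_sum lookup_single when_def)

lemma coef_linear_form_other: "expdeg \<alpha> \<noteq> 1 \<Longrightarrow> coef (linear_form b) \<alpha> = 0"
  by (auto simp: linear_form_eq lookup_sum lookup_single when_def intro!: sum.neutral)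

lemma coef_diag_form_other: "expdeg \<alpha> \<noteq> 2 \<Longrightarrow> coef (diag_form c) \<alpha> = 0"
  by (auto simp: diag_form_eq lookup_sum lookup_single when_def intro!: sum.neutral)

lemma pdeg_linear_form: "1 \<le> k \<Longrightarrow> pdeg (linear_form b) \<le> k"
  by (auto simp: linear_form_eq intro!: pdeg_sum_le pdeg_term_le)

lemma pdeg_diag_form: "2 \<le> k \<Longrightarrow> pdeg (diag_form c) \<le> k"
  by (auto simp: diag_form_eq intro!: pdeg_sum_le pdeg_term_le)

lemma peval_linear_form: "peval (linear_form b) x = b \<bullet> x"
  by (simp add: linear_form_eq inner_vec_def)

lemma peval_diag_form: "peval (diag_form c) x = (\<Sum>i\<in>UNIV. c $ i * (x $ i) ^ 2)"
  by (simp add: diag_form_eq)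

lemma l1norm_perturbation_le:
  assumes "\<And>i. 0 \<le> lam $ i"
  shows "l1norm (linear_form b + diag_form lam) \<le> sdp_objective (b, lam)"
proof -
  have "l1norm (linear_form b) \<le> vec_l1norm b"
    unfolding linear_form_eq vec_l1norm_def by (rule order_trans[OF l1norm_sum_le]) simp
  moreover have "l1norm (diag_form lam) \<le> (\<Sum>i\<in>UNIV. lam $ i)"
    unfolding diag_form_eq by (rule order_trans[OF l1norm_sum_le]) (simp add: assms)
  ultimately show ?thesis
    using l1norm_add_le[of "linear_form b" "diag_form lam"] by (simp add: sdp_objective_def)
qed

lemma poly_split_by_degree:
  fixes p :: "'n::finite rpoly"
  defines "R \<equiv> {\<alpha>\<in>Poly_Mapping.keys p. 2 \<le> expdeg \<alpha>}" and "b \<equiv> (\<chi> i. coef p (unit_exp i))"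
  shows "p = Const (coef p 0) + linear_form b + (\<Sum>\<alpha>\<in>R. mterm \<alpha> (coef p \<alpha>))" (is ?decomposition)
    and "l1norm p = \<bar>coef p 0\<bar> + vec_l1norm b + (\<Sum>\<alpha>\<in>R. \<bar>coef p \<alpha>\<bar>)" (is ?norm)
proof -
  let ?E = "range (unit_exp :: 'n \<Rightarrow> _)"
  define A where "A = insert 0 (?E \<union> R)"
  have fin: "finite R" by (simp add: R_def)
  have disj: "0 \<notin> ?E \<union> R" "?E \<inter> R = {}"
    by (auto simp: R_def dest: arg_cong[of _ _ expdeg])
  have cover: "Poly_Mapping.keys p \<subseteq> A"
  proof
    fix \<alpha> assume "\<alpha> \<in> Poly_Mapping.keys p"
    moreover consider "\<alpha> = 0" | i where "\<alpha> = unit_exp i" | "2 \<le> expdeg \<alpha>"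
      using expdeg_eq_0_iff[of \<alpha>] expdeg_1_iff[of \<alpha>] by fastforce
    ultimately show "\<alpha> \<in> A"
      by cases (auto simp: A_def R_def)
  qed
  have split: "(\<Sum>\<alpha>\<in>A. F \<alpha>) = F 0 + (\<Sum>i\<in>UNIV. F (unit_exp i)) + (\<Sum>\<alpha>\<in>R. F \<alpha>)"
    for F :: "_ \<Rightarrow> 'b::comm_monoid_add"
  proof -
    have "(\<Sum>\<alpha>\<in>?E. F \<alpha>) = (\<Sum>i\<in>UNIV. F (unit_exp i))"
      by (subst sum.reindex) (auto simp: inj_on_def)
    then show ?thesis
      unfolding A_def using disj fin by (simp add: sum.union_disjoint add.assoc)
  qed
  show ?decomposition
    using poly_eq_sum_terms[OF _ cover] split[of "\<lambda>\<alpha>. mterm \<alpha> (coef p \<alpha>)"] fin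
    by (simp add: A_def Const_def linear_form_eq b_def)
  show ?norm
    using l1norm_superset[OF _ cover] split[of "\<lambda>\<alpha>. \<bar>coef p \<alpha>\<bar>"] fin
    by (simp add: A_def vec_l1norm_def b_def)
qed

section \<open>The truncated quadratic module\<close>

lemma zero_in_SOS [simp]: "0 \<in> SOS r"
  by (auto simp: SOS_def is_sos_def intro!: exI[of _ "0::nat"])

lemma is_sos_add:
  assumes "is_sos s" "is_sos t"
  shows "is_sos (s + t)"
proof -
  obtain M N p q where s: "s = (\<Sum>k<(M::nat). p k ^ 2)" and t: "t = (\<Sum>k<(N::nat). q k ^ 2)"
    using assms by (auto simp: is_sos_def)
  have "s + t = (\<Sum>k<M + N. (if k < M then p k else q (k - M)) ^ 2)"
    unfolding s t by (subst add.commute, induction N) (auto simp: add_ac)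
  then show ?thesis
    unfolding is_sos_def by (intro exI[of _ "M + N"] exI[of _ "\<lambda>k. if k < M then p k else q (k - M)"])
qed

lemma SOS_add:
  assumes "s \<in> SOS r" "t \<in> SOS r"
  shows "s + t \<in> SOS r"
proof -
  have "int (pdeg (s + t)) \<le> 2 * r" if "int (pdeg s) \<le> 2 * r" "int (pdeg t) \<le> 2 * r"
    using pdeg_add_le[of s "nat (2 * r)" t] that by linarith
  then show ?thesis
    using assms by (auto simp: SOS_def is_sos_add)
qed

lemma SOS_mono: "r \<le> r' \<Longrightarrow> SOS r \<subseteq> SOS r'"
  by (auto simp: SOS_def)

lemma is_sos_power2: "is_sos (p ^ 2)"
  unfolding is_sos_def by (rule exI[of _ 1], rule exI[of _ "\<lambda>_. p"]) simp

lemma peval_sos_nonneg: "is_sos s \<Longrightarrow> 0 \<le> peval s x"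
  by (auto simp: is_sos_def intro!: sum_nonneg)

lemma square_term_in_SOS:
  assumes "0 \<le> c" "expdeg \<beta> \<le> r"
  shows "mterm (\<beta> + \<beta>) c \<in> SOS (int r)"
proof -
  have "mterm (\<beta> + \<beta>) c = mterm \<beta> (sqrt c) ^ 2"
    using assms(1) by (simp add: power2_eq_square mult_single)
  moreover have "pdeg (mterm (\<beta> + \<beta>) c) \<le> 2 * r"
    using assms(2) by (intro pdeg_term_le) simp
  ultimately show ?thesis
    using is_sos_power2[of "mterm \<beta> (sqrt c)"] by (auto simp: SOS_def)
qed

text \<open>This is \<open>\<bar>c\<bar> / 2\<close> times the square of \<open>x\<^sup>\<beta> - x\<^sup>\<gamma>\<close> or \<open>x\<^sup>\<beta> + x\<^sup>\<gamma>\<close>, according to the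
  sign of \<open>c\<close>.\<close>

lemma half_squares_minus_term_in_SOS:
  assumes "expdeg \<beta> \<le> r" "expdeg \<gamma> \<le> r"
  shows "mterm (\<beta> + \<beta>) (\<bar>c\<bar> / 2) + mterm (\<gamma> + \<gamma>) (\<bar>c\<bar> / 2) - mterm (\<beta> + \<gamma>) c \<in> SOS (int r)"
    (is "?s \<in> _")
proof -
  define a where "a = sqrt (\<bar>c\<bar> / 2)"
  define e where "e = - (sgn c * a)"
  have aa: "a * a = \<bar>c\<bar> / 2" by (simp add: a_def)
  have ee: "e * e = \<bar>c\<bar> / 2"
    using aa by (cases "c = 0") (auto simp: e_def sgn_if)
  have "a * e + a * e = - c"
    using aa by (auto simp: e_def sgn_if algebra_simps)
  then have ae: "mterm (\<beta> + \<gamma>) (a * e) + mterm (\<beta> + \<gamma>) (a * e) = - mterm (\<beta> + \<gamma>) c"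
    by (simp only: single_add[symmetric] single_uminus)
  have "(mterm \<beta> a + mterm \<gamma> e) ^ 2
      = mterm (\<beta> + \<beta>) (a * a) + mterm (\<gamma> + \<gamma>) (e * e)
        + (mterm (\<beta> + \<gamma>) (a * e) + mterm (\<beta> + \<gamma>) (a * e))"
    by (simp add: power2_eq_square distrib_left distrib_right mult_single add_ac mult.commute)
  then have "?s = (mterm \<beta> a + mterm \<gamma> e) ^ 2"
    by (simp add: aa ee ae)
  moreover have "pdeg ?s \<le> 2 * r"
    using assms by (intro pdeg_diff_le pdeg_add_le pdeg_term_le) auto
  ultimately show ?thesis
    using is_sos_power2[of "mterm \<beta> a + mterm \<gamma> e"] by (auto simp: SOS_def)
qed

lemma zero_in_Qmod: "0 \<in> Qmod d m g"
  unfolding Qmod_def by (rule CollectI, rule exI[of _ "\<lambda>_. 0"]) simp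

lemma Qmod_add:
  assumes "p \<in> Qmod d m g" "q \<in> Qmod d m g"
  shows "p + q \<in> Qmod d m g"
proof -
  obtain \<sigma> \<tau> where \<sigma>: "p = (\<Sum>j\<in>con_idx0 m. \<sigma> j * con g j)"
      "\<forall>j\<in>con_idx0 m. \<sigma> j \<in> SOS (int d - half_deg (con g j))"
    and \<tau>: "q = (\<Sum>j\<in>con_idx0 m. \<tau> j * con g j)"
      "\<forall>j\<in>con_idx0 m. \<tau> j \<in> SOS (int d - half_deg (con g j))"
    using assms by (auto simp: Qmod_def)
  have "p + q = (\<Sum>j\<in>con_idx0 m. (\<sigma> j + \<tau> j) * con g j)"
    by (simp add: \<sigma>(1) \<tau>(1) distrib_right sum.distrib)
  then show ?thesis
    unfolding Qmod_def using \<sigma>(2) \<tau>(2) by (auto intro!: exI[of _ "\<lambda>j. \<sigma> j + \<tau> j"] SOS_add)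
qed

lemma Qmod_sum: "(\<And>k. k \<in> A \<Longrightarrow> p k \<in> Qmod d m g) \<Longrightarrow> (\<Sum>k\<in>A. p k) \<in> Qmod d m g"
  by (induction A rule: infinite_finite_induct) (auto simp: zero_in_Qmod Qmod_add)

lemma mult_con_in_Qmod:
  assumes "j \<in> con_idx0 m" "s \<in> SOS (int d - half_deg (con g j))"
  shows "s * con g j \<in> Qmod d m g"
proof -
  have "(\<Sum>i\<in>con_idx0 m. (if i = j then s else 0) * con g i)
      = (\<Sum>i\<in>con_idx0 m. if i = j then s * con g j else 0)"
    by (rule sum.cong) auto
  then have "s * con g j = (\<Sum>i\<in>con_idx0 m. (if i = j then s else 0) * con g i)"
    using assms(1) by simp
  then show ?thesis
    unfolding Qmod_def using assms(2) by (intro CollectI exI[of _ "\<lambda>i. if i = j then s else 0"]) auto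
qed

lemma SOS_subset_Qmod:
  fixes g :: "nat \<Rightarrow> 'n::finite rpoly"
  shows "SOS (int d) \<subseteq> Qmod d m g"
proof
  fix s :: "'n rpoly" assume "s \<in> SOS (int d)"
  moreover have "half_deg (1 :: 'n rpoly) = 0"
    by (simp add: half_deg_def pdeg_def)
  moreover have "Inl 0 \<in> con_idx0 m" by (intro InlI) simp
  ultimately show "s \<in> Qmod d m g"
    using mult_con_in_Qmod[of "Inl 0" m s d g] by simp
qed

lemma box_mult_in_Qmod:
  assumes "s \<in> SOS (int d - 1)"
  shows "s * (1 - Var i ^ 2) \<in> Qmod d m g"
proof -
  have "pdeg (1 - Var i ^ 2) \<le> 2"
    by (intro pdeg_diff_le) (auto simp: Var_power2 pdeg_le_iff)
  then have "half_deg (1 - Var i ^ 2) \<le> 1"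
    by (simp add: half_deg_def ceiling_le_iff)
  then have "SOS (int d - 1) \<subseteq> SOS (int d - half_deg (1 - Var i ^ 2))"
    by (intro SOS_mono) simp
  then show ?thesis
    using mult_con_in_Qmod[of "Inr i" m s d g] assms by auto
qed

text \<open>Telescoping along the variables of \<open>x\<^sup>\<delta>\<close>: removing one factor \<open>x\<^sub>k\<close> from a squared
  monomial \<open>(x\<^sub>k q)\<^sup>2\<close> changes it by \<open>q\<^sup>2 (1 - x\<^sub>k\<^sup>2)\<close>, which respects the truncation as long as \<open>q\<close> has
  degree at most \<open>d - 1\<close>. The variable \<open>x\<^sub>i\<close> is kept to the end.\<close>

lemma square_minus_term_in_Qmod:
  assumes "0 \<le> c" "Suc (expdeg \<delta>) \<le> d"
  shows "mterm (Poly_Mapping.single i 2) c - mterm ((unit_exp i + \<delta>) + (unit_exp i + \<delta>)) c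
    \<in> Qmod d m g"
  using assms(2)
proof (induction "expdeg \<delta>" arbitrary: \<delta>)
  case 0
  have "Poly_Mapping.single i 2 = unit_exp i + unit_exp i"
    by (simp add: single_add[symmetric] numeral_2_eq_2)
  moreover have "\<delta> = 0" using 0 by simp
  ultimately show ?case by (simp add: zero_in_Qmod)
next
  case (Suc n)
  then obtain k \<delta>' where \<delta>: "\<delta> = unit_exp k + \<delta>'" "expdeg \<delta>' = n"
    using expdeg_Suc_split by metis
  let ?\<beta> = "unit_exp i + \<delta>'"
  have "mterm (?\<beta> + ?\<beta>) c \<in> SOS (int (d - 1))"
    using Suc.prems \<delta> assms(1) by (intro square_term_in_SOS) auto
  then have "mterm (?\<beta> + ?\<beta>) c * (1 - Var k ^ 2) \<in> Qmod d m g"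
    using Suc.prems by (intro box_mult_in_Qmod) (simp add: of_nat_diff)
  moreover have "mterm (?\<beta> + ?\<beta>) c * (1 - Var k ^ 2)
      = mterm (?\<beta> + ?\<beta>) c - mterm ((unit_exp i + \<delta>) + (unit_exp i + \<delta>)) c"
  proof -
    have "(unit_exp i + \<delta>) + (unit_exp i + \<delta>) = (?\<beta> + ?\<beta>) + Poly_Mapping.single k 2"
      unfolding \<delta>(1) by (rule poly_mapping_eqI) (simp add: lookup_add lookup_single when_def)
    then show ?thesis
      by (simp only: right_diff_distrib Var_power2 mult_single mult_1_right)
  qed
  moreover have "mterm (Poly_Mapping.single i 2) c - mterm (?\<beta> + ?\<beta>) c \<in> Qmod d m g"
    using Suc.hyps(1)[of \<delta>'] Suc.hyps(2) Suc.prems \<delta>(2) by simp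
  ultimately show ?case
    using Qmod_add[of "mterm (Poly_Mapping.single i 2) c - mterm (?\<beta> + ?\<beta>) c" d m g
        "mterm (?\<beta> + ?\<beta>) c - mterm ((unit_exp i + \<delta>) + (unit_exp i + \<delta>)) c"]
    by (simp only: diff_add_cancel add_diff_eq)
qed

text \<open>The key estimate: modulo the truncated quadratic module a term of degree at least 2 is
  dominated by a diagonal quadratic form of the same norm.\<close>

lemma diag_form_minus_term_in_Qmod:
  fixes \<alpha> :: "'n::finite \<Rightarrow>\<^sub>0 nat" and g :: "nat \<Rightarrow> 'n rpoly"
  assumes "2 \<le> expdeg \<alpha>" "expdeg \<alpha> \<le> 2 * d"
  shows "\<exists>w. (\<forall>i. 0 \<le> w $ i) \<and> (\<Sum>i\<in>UNIV. w $ i) = \<bar>c\<bar> \<and>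
    diag_form w - mterm \<alpha> c \<in> Qmod d m g"
proof -
  \<comment> \<open>Halving the degree keeps both factors nonconstant and of degree at most \<open>d\<close>.\<close>
  have "expdeg \<alpha> = expdeg \<alpha> div 2 + (expdeg \<alpha> - expdeg \<alpha> div 2)" by simp
  from expdeg_split[OF this] obtain \<beta> \<gamma> where \<alpha>: "\<alpha> = \<beta> + \<gamma>"
    and deg: "expdeg \<beta> = expdeg \<alpha> div 2" "expdeg \<gamma> = expdeg \<alpha> - expdeg \<alpha> div 2"
    by blast
  have bounds: "1 \<le> expdeg \<beta>" "expdeg \<beta> \<le> d" "1 \<le> expdeg \<gamma>" "expdeg \<gamma> \<le> d"
    using assms deg by linarith+
  obtain i \<beta>' where \<beta>: "\<beta> = unit_exp i + \<beta>'"
    using expdeg_Suc_split bounds(1) by (metis One_nat_def Suc_le_D)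
  obtain k \<gamma>' where \<gamma>: "\<gamma> = unit_exp k + \<gamma>'"
    using expdeg_Suc_split bounds(3) by (metis One_nat_def Suc_le_D)
  define w :: "real ^ 'n" where "w = axis i (\<bar>c\<bar> / 2) + axis k (\<bar>c\<bar> / 2)"
  have "mterm (Poly_Mapping.single i 2) (\<bar>c\<bar> / 2) - mterm (\<beta> + \<beta>) (\<bar>c\<bar> / 2) \<in> Qmod d m g"
    unfolding \<beta> using bounds(2) by (intro square_minus_term_in_Qmod) (simp_all add: \<beta>)
  moreover have "mterm (Poly_Mapping.single k 2) (\<bar>c\<bar> / 2) - mterm (\<gamma> + \<gamma>) (\<bar>c\<bar> / 2) \<in> Qmod d m g"
    unfolding \<gamma> using bounds(4) by (intro square_minus_term_in_Qmod) (simp_all add: \<gamma>)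
  moreover have "mterm (\<beta> + \<beta>) (\<bar>c\<bar> / 2) + mterm (\<gamma> + \<gamma>) (\<bar>c\<bar> / 2) - mterm \<alpha> c \<in> Qmod d m g"
    unfolding \<alpha> using half_squares_minus_term_in_SOS[OF bounds(2,4)] SOS_subset_Qmod by blast
  ultimately have "(mterm (Poly_Mapping.single i 2) (\<bar>c\<bar> / 2) - mterm (\<beta> + \<beta>) (\<bar>c\<bar> / 2))
      + (mterm (Poly_Mapping.single k 2) (\<bar>c\<bar> / 2) - mterm (\<gamma> + \<gamma>) (\<bar>c\<bar> / 2))
      + (mterm (\<beta> + \<beta>) (\<bar>c\<bar> / 2) + mterm (\<gamma> + \<gamma>) (\<bar>c\<bar> / 2) - mterm \<alpha> c) \<in> Qmod d m g"
    (is "?S \<in> _")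
    by (intro Qmod_add)
  also have "?S = diag_form w - mterm \<alpha> c"
    by (simp add: w_def diag_form_add diag_form_axis)
  finally have "diag_form w - mterm \<alpha> c \<in> Qmod d m g" .
  moreover have "(\<Sum>j\<in>UNIV. w $ j) = \<bar>c\<bar>"
  proof -
    have "(\<Sum>j\<in>UNIV. axis l a $ j) = a" for l :: 'n and a :: real
      by (simp add: axis_def)
    then show ?thesis by (simp add: w_def sum.distrib)
  qed
  moreover have "\<forall>j. 0 \<le> w $ j"
    by (simp add: w_def axis_def)
  ultimately show ?thesis by blast
qed

section \<open>From the inverse problem to the semidefinite program\<close>

lemma inv_feasible_iff:
  "inv_feasible d m g f h \<longleftrightarrow> pdeg h \<le> pdeg f \<and> h - Const (peval h 0) \<in> Qmod d m g"
proof -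
  have "(\<forall>x. peval h x - peval h 0 = (\<Sum>j\<in>con_idx0 m. peval (\<sigma> j) x * peval (con g j) x))
      \<longleftrightarrow> h - Const (peval h 0) = (\<Sum>j\<in>con_idx0 m. \<sigma> j * con g j)" (is "?L \<longleftrightarrow> ?R") for \<sigma>
  proof
    assume ?L
    then show ?R by (intro peval_inject) simp
  next
    assume R: ?R
    show ?L
    proof
      fix x
      show "peval h x - peval h 0 = (\<Sum>j\<in>con_idx0 m. peval (\<sigma> j) x * peval (con g j) x)"
        using arg_cong[OF R, of "\<lambda>p. peval p x"] by simp
    qed
  qed
  then show ?thesis
    unfolding inv_feasible_def Qmod_def by auto
qed

lemma inv_feasible_of_sdp_feasible:
  assumes "sdp_feasible d m g f (b, lam)" "pdeg f = 0 \<longrightarrow> b = 0 \<and> lam = 0"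
  shows "inv_feasible d m g f (f + linear_form b + diag_form lam)"
proof -
  have "pdeg (linear_form b) \<le> pdeg f"
    using assms(2) by (cases "pdeg f = 0") (simp_all add: pdeg_linear_form)
  moreover have "pdeg (diag_form lam) \<le> pdeg f"
  proof (cases "2 \<le> pdeg f")
    case False
    then have "lam = 0"
      using assms by (cases "pdeg f = 0") (auto simp: sdp_feasible_def)
    then show ?thesis by simp
  qed (simp add: pdeg_diag_form)
  ultimately have "pdeg (f + linear_form b + diag_form lam) \<le> pdeg f"
    by (intro pdeg_add_le) auto
  moreover have "peval (f + linear_form b + diag_form lam) 0 = peval f 0"
    by (simp add: peval_linear_form peval_diag_form)
  ultimately show ?thesis
    using assms(1) by (simp add: inv_feasible_iff sdp_feasible_def algebra_simps)
qed

text \<open>A point of the program is turned into a feasible polynomial, except for constant \<open>f\<close>,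
  where the perturbed polynomial might exceed the degree of \<open>f\<close>; but then \<open>f\<close> itself is feasible and
  the optimal value is zero.\<close>

lemma l1norm_le_sdp_objective:
  assumes "inv_optimal d m g f ft" "sdp_feasible d m g f (b, lam)"
  shows "l1norm (f - ft) \<le> sdp_objective (b, lam)"
proof -
  have nonneg: "\<And>i. 0 \<le> lam $ i"
    using assms(2) by (simp add: sdp_feasible_def)
  have opt: "l1norm (f - ft) \<le> l1norm (f - h)" if "inv_feasible d m g f h" for h
    using assms(1) that by (auto simp: inv_optimal_def is_arg_min_def not_less)
  show ?thesis
  proof (cases "pdeg f = 0")
    case True
    then have "f = Const (peval f 0)"
      using expdeg_le_pdeg[of f]
      by (intro poly_mapping_eqI)
        (auto simp: Const_def lookup_single when_def peval_at_zero dest!: expdeg_eq_0_iff[THEN iffD1])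
    then have "inv_feasible d m g f f"
      by (metis inv_feasible_iff cancel_comm_monoid_add_class.diff_cancel order_refl zero_in_Qmod)
    from opt[OF this] have "l1norm (f - ft) \<le> 0" by simp
    also have "0 \<le> sdp_objective (b, lam)"
      using nonneg by (simp add: sdp_objective_def vec_l1norm_def sum_nonneg)
    finally show ?thesis .
  next
    case False
    then have "l1norm (f - ft) \<le> l1norm (f - (f + linear_form b + diag_form lam))"
      using assms(2) by (intro opt inv_feasible_of_sdp_feasible) auto
    also have "\<dots> = l1norm (linear_form b + diag_form lam)"
      using l1norm_uminus[of "linear_form b + diag_form lam"] by simp
    also have "\<dots> \<le> sdp_objective (b, lam)"
      using nonneg by (rule l1norm_perturbation_le)
    finally show ?thesis .
  qed
qed

text \<open>The compression step: all terms of degree at least 2 of the perturbation are traded for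
  squares, and its constant term, which feasibility ignores, is dropped. The term \<open>\<bar>coef (ft - f) 0\<bar>\<close> in the
  balance records the norm that is saved, and shows later that an optimal \<open>ft\<close> has the constant term
  of \<open>f\<close>.\<close>

lemma sdp_feasible_of_inv_feasible:
  fixes f ft :: "'n::finite rpoly"
  assumes feas: "inv_feasible d m g f ft" and deg: "pdeg f \<le> 2 * d"
  defines "b \<equiv> (\<chi> i. coef (ft - f) (unit_exp i))"
  shows "\<exists>lam. sdp_feasible d m g f (b, lam) \<and> (pdeg f = 0 \<longrightarrow> b = 0 \<and> lam = 0) \<and>
    \<bar>coef (ft - f) 0\<bar> + sdp_objective (b, lam) = l1norm (ft - f) \<and>
    (pdeg f \<le> 1 \<longrightarrow> ft = f + Const (coef (ft - f) 0) + linear_form b)"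
proof -
  define p where "p = ft - f"
  define R where "R = {\<alpha>\<in>Poly_Mapping.keys p. 2 \<le> expdeg \<alpha>}"
  have p: "p = Const (coef p 0) + linear_form b + (\<Sum>\<alpha>\<in>R. mterm \<alpha> (coef p \<alpha>))"
    and norm: "l1norm p = \<bar>coef p 0\<bar> + vec_l1norm b + (\<Sum>\<alpha>\<in>R. \<bar>coef p \<alpha>\<bar>)"
    using poly_split_by_degree[of p] by (auto simp: R_def b_def p_def)
  have "pdeg p \<le> pdeg f"
    unfolding p_def using feas by (intro pdeg_diff_le) (auto simp: inv_feasible_def)
  then have degp: "coef p \<alpha> \<noteq> 0 \<Longrightarrow> expdeg \<alpha> \<le> pdeg f" for \<alpha>
    using expdeg_le_pdeg order_trans by blast
  have R_small: "R = {}" if "pdeg f \<le> 1"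
    using degp that by (force simp: R_def in_keys_iff)
  have b_small: "b = 0" if "pdeg f = 0"
    using degp[of "unit_exp _"] that by (auto simp: b_def p_def vec_eq_iff)
  have "\<forall>\<alpha>\<in>R. \<exists>w. (\<forall>i. 0 \<le> w $ i) \<and> (\<Sum>i\<in>UNIV. w $ i) = \<bar>coef p \<alpha>\<bar> \<and>
      diag_form w - mterm \<alpha> (coef p \<alpha>) \<in> Qmod d m g"
    using degp deg
    by (intro ballI diag_form_minus_term_in_Qmod) (auto simp: R_def in_keys_iff intro: order_trans)
  then obtain w where w: "\<And>\<alpha> i. \<alpha> \<in> R \<Longrightarrow> 0 \<le> w \<alpha> $ i"
      "\<And>\<alpha>. \<alpha> \<in> R \<Longrightarrow> (\<Sum>i\<in>UNIV. w \<alpha> $ i) = \<bar>coef p \<alpha>\<bar>"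
      "\<And>\<alpha>. \<alpha> \<in> R \<Longrightarrow> diag_form (w \<alpha>) - mterm \<alpha> (coef p \<alpha>) \<in> Qmod d m g"
    by metis
  define lam where "lam = (\<Sum>\<alpha>\<in>R. w \<alpha>)"
  have lam_nonneg: "0 \<le> lam $ i" for i
    by (simp add: lam_def w(1) sum_nonneg)
  have "(\<Sum>i\<in>UNIV. lam $ i) = (\<Sum>\<alpha>\<in>R. \<bar>coef p \<alpha>\<bar>)"
    by (simp add: lam_def sum.swap[of _ R] w(2))
  then have obj: "\<bar>coef p 0\<bar> + sdp_objective (b, lam) = l1norm p"
    by (simp add: sdp_objective_def norm)
  have "(ft - Const (peval ft 0)) + (\<Sum>\<alpha>\<in>R. diag_form (w \<alpha>) - mterm \<alpha> (coef p \<alpha>)) \<in> Qmod d m g"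
    using feas w(3) by (intro Qmod_add Qmod_sum) (auto simp: inv_feasible_iff)
  also have "(ft - Const (peval ft 0)) + (\<Sum>\<alpha>\<in>R. diag_form (w \<alpha>) - mterm \<alpha> (coef p \<alpha>))
      = f - Const (peval f 0) + linear_form b + diag_form lam"
  proof -
    have "(Const (peval ft 0) :: 'n rpoly) = Const (coef p 0) + Const (peval f 0)"
      by (simp add: Const_def p_def peval_at_zero lookup_minus single_add[symmetric])
    then have "ft - Const (peval ft 0) = (ft - Const (coef p 0)) - Const (peval f 0)"
      by (simp only: diff_diff_add)
    also have "ft - Const (coef p 0) = f + linear_form b + (\<Sum>\<alpha>\<in>R. mterm \<alpha> (coef p \<alpha>))"
      using p by (simp add: p_def algebra_simps)
    finally show ?thesis
      by (simp add: lam_def diag_form_sum sum_subtractf)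
  qed
  finally have "sdp_feasible d m g f (b, lam)"
    using lam_nonneg R_small by (simp add: sdp_feasible_def lam_def)
  moreover have "pdeg f \<le> 1 \<longrightarrow> ft = f + Const (coef p 0) + linear_form b"
  proof
    assume "pdeg f \<le> 1"
    then show "ft = f + Const (coef p 0) + linear_form b"
      using p R_small by (simp add: p_def algebra_simps)
  qed
  moreover have "pdeg f = 0 \<longrightarrow> b = 0 \<and> lam = 0"
    using b_small R_small by (simp add: lam_def)
  ultimately show ?thesis
    using obj unfolding p_def[symmetric] by (intro exI[of _ lam] conjI)
qed

section \<open>Gradients at the origin\<close>

lemma GDERIV_peval_exists:
  fixes p :: "'n::finite rpoly"
  shows "\<exists>D. GDERIV (peval p) x :> D"
proof -
  have "(\<lambda>x. peval p x) differentiable (at x)"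
  proof -
    have "(\<lambda>x :: real ^ 'n. \<Prod>i\<in>I. (x $ i) ^ k i) differentiable (at x)"
      for I :: "'n set" and k :: "'n \<Rightarrow> nat"
      by (induction I rule: infinite_finite_induct)
        (auto intro!: differentiable_mult differentiable_power
          bounded_linear_imp_differentiable[OF bounded_linear_vec_nth])
    then show ?thesis
      unfolding peval_def by (intro differentiable_sum differentiable_mult) auto
  qed
  then obtain f' where f': "((\<lambda>x. peval p x) has_derivative f') (at x)"
    by (auto simp: differentiable_def)
  then have "f' h = h \<bullet> adjoint f' 1" for h
    using adjoint_works[OF has_derivative_linear[OF f'], of h 1] by simp
  then have "f' = (\<lambda>h. h \<bullet> adjoint f' 1)" by blast
  with f' have "(peval p has_derivative (\<lambda>h. h \<bullet> adjoint f' 1)) (at x)" by metis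
  then show ?thesis
    unfolding gderiv_def by blast
qed

lemma GDERIV_unique:
  assumes "GDERIV f x :> D" "GDERIV f x :> E"
  shows "D = E"
proof -
  have "(\<lambda>h. h \<bullet> D) = (\<lambda>h. h \<bullet> E)"
    using assms has_derivative_unique unfolding gderiv_def by blast
  then have "\<forall>h. h \<bullet> D = h \<bullet> E" by metis
  then show ?thesis using vector_eq_ldot by blast
qed

lemma grad_eqI: "GDERIV f x :> D \<Longrightarrow> grad f x = D"
  unfolding grad_def by (rule the_equality) (auto intro: GDERIV_unique)

lemma GDERIV_peval: "GDERIV (peval p) x :> grad (peval p) x"
  using GDERIV_peval_exists[of p x] grad_eqI by metis

lemma GDERIV_sum:
  "(\<And>k. k \<in> A \<Longrightarrow> GDERIV (F k) x :> D k) \<Longrightarrow> GDERIV (\<lambda>x. \<Sum>k\<in>A. F k x) x :> (\<Sum>k\<in>A. D k)"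
  unfolding gderiv_def by (auto simp: inner_sum_right intro: has_derivative_sum)

lemma grad_at_minimum_eq_zero:
  assumes "\<And>y. peval p x \<le> peval p y"
  shows "grad (peval p) x = 0"
proof -
  have "(\<lambda>h. h \<bullet> grad (peval p) x) = (\<lambda>_. 0)"
    using GDERIV_peval[of p x] assms unfolding gderiv_def
    by (intro differential_zero_maxmin[of x UNIV "peval p"]) auto
  then show ?thesis
    using fun_cong[of "\<lambda>h. h \<bullet> grad (peval p) x" _ "grad (peval p) x"] by simp
qed

text \<open>The diagonal form vanishes to second order at the origin, so that only \<open>b\<close> is left of the
  perturbation.\<close>

lemma grad_perturbation_at_zero:
  "grad (peval (f - Const c + linear_form b + diag_form lam)) 0 = grad (peval f) 0 + b"
proof -
  have "GDERIV (\<lambda>x. b \<bullet> x) 0 :> b"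
    unfolding gderiv_def by (auto intro!: derivative_eq_intros simp: inner_commute)
  moreover have "GDERIV (\<lambda>x. \<Sum>i\<in>UNIV. lam $ i * (x $ i) ^ 2) 0 :> 0"
    unfolding gderiv_def
    by (auto intro!: derivative_eq_intros bounded_linear_imp_has_derivative bounded_linear_vec_nth)
  ultimately have "GDERIV (\<lambda>x. peval f x - c + b \<bullet> x + (\<Sum>i\<in>UNIV. lam $ i * (x $ i) ^ 2)) 0
      :> grad (peval f) 0 - 0 + b + 0"
    by (intro GDERIV_add GDERIV_diff GDERIV_peval GDERIV_const)
  moreover have "(\<lambda>x. peval f x - c + b \<bullet> x + (\<Sum>i\<in>UNIV. lam $ i * (x $ i) ^ 2))
      = peval (f - Const c + linear_form b + diag_form lam)"
    by (auto simp: peval_linear_form peval_diag_form)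
  ultimately show ?thesis
    using grad_eqI by fastforce
qed

text \<open>Complementary slackness at a zero of \<open>q\<close> in the feasible set, with multipliers
  \<open>\<theta> j = \<sigma> j x\<close>. An inactive \<open>j\<close> contributes nothing because \<open>\<sigma> j\<close> is nonnegative and vanishes at \<open>x\<close>, hence has a
  critical point there.\<close>

lemma grad_Qmod_at_zero:
  assumes "q \<in> Qmod d m g" "x \<in> feas_set m g" "peval q x = 0"
  shows "\<exists>\<theta>. (\<forall>j\<in>active m g x. 0 \<le> \<theta> j) \<and>
    grad (peval q) x = (\<Sum>j\<in>active m g x. \<theta> j *\<^sub>R grad (peval (con g j)) x)"
proof -
  obtain \<sigma> where q: "q = (\<Sum>j\<in>con_idx0 m. \<sigma> j * con g j)"
    and sos: "\<And>j. j \<in> con_idx0 m \<Longrightarrow> is_sos (\<sigma> j)"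
    using assms(1) by (auto simp: Qmod_def SOS_def)
  have con: "0 \<le> peval (con g j) x" if "j \<in> con_idx0 m" for j
  proof (cases "j = Inl 0")
    case False
    then have "j \<in> con_idx m" using that by (auto simp: Suc_le_eq)
    then show ?thesis using assms(2) by (simp add: feas_set_def)
  qed simp
  have term_zero: "peval (\<sigma> j) x * peval (con g j) x = 0" if "j \<in> con_idx0 m" for j
  proof -
    have "(\<Sum>j\<in>con_idx0 m. peval (\<sigma> j) x * peval (con g j) x) = 0"
      using assms(3) by (simp add: q)
    moreover have "0 \<le> peval (\<sigma> i) x * peval (con g i) x" if "i \<in> con_idx0 m" for i
      using con[OF that] peval_sos_nonneg[OF sos[OF that]] by simp
    ultimately show ?thesis
      using that sum_nonneg_eq_0_iff[of "con_idx0 m" "\<lambda>j. peval (\<sigma> j) x * peval (con g j) x"]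
      by (simp del: con.simps)
  qed
  have inactive: "peval (\<sigma> j) x = 0 \<and> grad (peval (\<sigma> j)) x = 0"
    if "j \<in> con_idx0 m" "j \<notin> active m g x" for j
  proof -
    have "peval (con g j) x \<noteq> 0"
    proof (cases "j = Inl 0")
      case False
      then have "j \<in> con_idx m" using that by (auto simp: Suc_le_eq)
      then show ?thesis using that(2) by (simp add: active_def)
    qed simp
    then have "peval (\<sigma> j) x = 0" using term_zero[OF that(1)] by simp
    moreover from this have "grad (peval (\<sigma> j)) x = 0"
      using peval_sos_nonneg[OF sos[OF that(1)]] by (intro grad_at_minimum_eq_zero) simp
    ultimately show ?thesis by simp
  qed
  have "peval q = (\<lambda>x. \<Sum>j\<in>con_idx0 m. peval (\<sigma> j) x * peval (con g j) x)"
    by (auto simp: q)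
  then have "grad (peval q) x = (\<Sum>j\<in>con_idx0 m. peval (\<sigma> j) x *\<^sub>R grad (peval (con g j)) x
      + peval (con g j) x *\<^sub>R grad (peval (\<sigma> j)) x)"
    by (simp only:) (intro grad_eqI GDERIV_sum GDERIV_mult GDERIV_peval)
  also have "\<dots> = (\<Sum>j\<in>active m g x. peval (\<sigma> j) x *\<^sub>R grad (peval (con g j)) x
      + peval (con g j) x *\<^sub>R grad (peval (\<sigma> j)) x)"
    by (rule sum.mono_neutral_right) (use inactive in \<open>auto simp: active_def\<close>)
  also have "\<dots> = (\<Sum>j\<in>active m g x. peval (\<sigma> j) x *\<^sub>R grad (peval (con g j)) x)"
    by (rule sum.cong) (auto simp: active_def)
  finally have "grad (peval q) x = (\<Sum>j\<in>active m g x. peval (\<sigma> j) x *\<^sub>R grad (peval (con g j)) x)" .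
  moreover have "active m g x \<subseteq> con_idx0 m"
    by (auto simp: active_def)
  then have "\<forall>j\<in>active m g x. 0 \<le> peval (\<sigma> j) x"
    using sos peval_sos_nonneg by blast
  ultimately show ?thesis
    by (intro exI[of _ "\<lambda>j. peval (\<sigma> j) x"] conjI)
qed

section \<open>The sparse form of optimal solutions\<close>

theorem theorem3p4:
  fixes f ft :: "'n::finite rpoly" and g :: "nat \<Rightarrow> 'n rpoly" and m d :: nat and \<rho> :: real
  assumes "0 \<in> feas_set m g"
    and "interior (feas_set m g) \<noteq> {}"
    and "pdeg f \<le> 2 * d"
    and "inv_optimal d m g f ft"
    and "\<rho> = l1norm (f - ft)"
  shows "\<exists>b lam.
      (pdeg f = 1 \<longrightarrow> ft = f + linear_form b) \<and>
      (pdeg f > 1 \<longrightarrow>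
         inv_optimal d m g f (f + linear_form b + diag_form lam) \<and>
         (\<forall>\<alpha>. expdeg \<alpha> \<le> 1 \<longrightarrow>
            Poly_Mapping.lookup ft \<alpha> = Poly_Mapping.lookup (f + linear_form b + diag_form lam) \<alpha>)) \<and>
      (\<forall>i. 0 \<le> lam $ i) \<and>
      sdp_optimal d m g f (b, lam) \<and>
      \<rho> = sdp_objective (b, lam) \<and>
      (\<exists>\<theta>. (\<forall>j\<in>active m g 0. 0 \<le> \<theta> j) \<and>
         b = - grad (peval f) 0 + (\<Sum>j\<in>active m g 0. \<theta> j *\<^sub>R grad (peval (con g j)) 0))"
proof -
  have feas: "inv_feasible d m g f ft"
    and opt: "\<And>h. inv_feasible d m g f h \<Longrightarrow> l1norm (f - ft) \<le> l1norm (f - h)"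
    using assms(4) by (auto simp: inv_optimal_def is_arg_min_def not_less)
  define b where "b = (\<chi> i. coef (ft - f) (unit_exp i))"
  obtain lam where sdp: "sdp_feasible d m g f (b, lam)"
    and deg0: "pdeg f = 0 \<longrightarrow> b = 0 \<and> lam = 0"
    and obj: "\<bar>coef (ft - f) 0\<bar> + sdp_objective (b, lam) = l1norm (ft - f)"
    and deg1: "pdeg f \<le> 1 \<longrightarrow> ft = f + Const (coef (ft - f) 0) + linear_form b"
    using sdp_feasible_of_inv_feasible[OF feas assms(3), folded b_def] by (elim exE conjE)
  have nonneg: "0 \<le> lam $ i" for i
    using sdp by (simp add: sdp_feasible_def)
  have sym: "l1norm (ft - f) = \<rho>"
    using l1norm_uminus[of "ft - f"] assms(5) by simp
  \<comment> \<open>The value of \<open>(b, lam)\<close> is \<open>\<rho> - \<bar>coef (ft - f) 0\<bar>\<close>, and no value is below \<open>\<rho>\<close>.\<close>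
  have const: "coef (ft - f) 0 = 0" and val: "\<rho> = sdp_objective (b, lam)"
    using l1norm_le_sdp_objective[OF assms(4) sdp] obj sym assms(5) by auto
  have sdp_opt: "sdp_optimal d m g f (b, lam)"
    unfolding sdp_optimal_def is_arg_min_def
  proof (intro conjI notI, rule sdp)
    assume "\<exists>y. sdp_feasible d m g f y \<and> sdp_objective y < sdp_objective (b, lam)"
    then obtain b' lam' where "sdp_feasible d m g f (b', lam')"
      "sdp_objective (b', lam') < sdp_objective (b, lam)"
      by force
    then show False
      using l1norm_le_sdp_objective[OF assms(4)] val assms(5) by fastforce
  qed
  have linear: "pdeg f = 1 \<longrightarrow> ft = f + linear_form b"
    using deg1 const by (simp add: Const_def)
  have inv_opt: "inv_optimal d m g f (f + linear_form b + diag_form lam)"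
    unfolding inv_optimal_def is_arg_min_def
  proof (intro conjI notI)
    show "inv_feasible d m g f (f + linear_form b + diag_form lam)"
      using sdp deg0 by (rule inv_feasible_of_sdp_feasible)
    have "l1norm (f - (f + linear_form b + diag_form lam)) = l1norm (linear_form b + diag_form lam)"
      using l1norm_uminus[of "linear_form b + diag_form lam"] by simp
    also have "\<dots> \<le> l1norm (f - ft)"
      using l1norm_perturbation_le[OF nonneg, of b] val assms(5) by simp
    finally have le: "l1norm (f - (f + linear_form b + diag_form lam)) \<le> l1norm (f - ft)" .
    assume "\<exists>h. inv_feasible d m g f h \<and>
      l1norm (f - h) < l1norm (f - (f + linear_form b + diag_form lam))"
    then show False
      using opt le by (meson less_le_not_le order_trans)
  qed
  have coefs: "\<forall>\<alpha>. expdeg \<alpha> \<le> 1 \<longrightarrow>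
      coef ft \<alpha> = coef (f + linear_form b + diag_form lam) \<alpha>"
  proof (intro allI impI)
    fix \<alpha> :: "'n \<Rightarrow>\<^sub>0 nat" assume "expdeg \<alpha> \<le> 1"
    then have "expdeg \<alpha> = 0 \<or> expdeg \<alpha> = 1" by linarith
    then consider "\<alpha> = 0" | i where "\<alpha> = unit_exp i"
      unfolding expdeg_1_iff expdeg_eq_0_iff by blast
    then show "coef ft \<alpha> = coef (f + linear_form b + diag_form lam) \<alpha>"
    proof cases
      case 1
      then show ?thesis
        using const by (simp add: lookup_add lookup_minus coef_linear_form_other coef_diag_form_other)
    next
      case 2
      have "coef (linear_form b) (unit_exp i) = coef ft (unit_exp i) - coef f (unit_exp i)"
        unfolding coef_linear_form_unit by (simp add: b_def lookup_minus)
      then show ?thesis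
        unfolding 2 by (simp add: lookup_add coef_diag_form_other)
    qed
  qed
  have multipliers: "\<exists>\<theta>. (\<forall>j\<in>active m g 0. 0 \<le> \<theta> j) \<and>
      b = - grad (peval f) 0 + (\<Sum>j\<in>active m g 0. \<theta> j *\<^sub>R grad (peval (con g j)) 0)"
  proof -
    let ?q = "f - Const (peval f 0) + linear_form b + diag_form lam"
    have q: "?q \<in> Qmod d m g" using sdp by (simp add: sdp_feasible_def)
    have q0: "peval ?q 0 = 0" by (simp add: peval_linear_form peval_diag_form)
    from grad_Qmod_at_zero[OF q assms(1) q0] obtain \<theta> where \<theta>: "\<forall>j\<in>active m g 0. 0 \<le> \<theta> j"
      and grad_q: "grad (peval ?q) 0 = (\<Sum>j\<in>active m g 0. \<theta> j *\<^sub>R grad (peval (con g j)) 0)"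
      by (elim exE conjE)
    have "b = - grad (peval f) 0 + grad (peval ?q) 0"
      unfolding grad_perturbation_at_zero by simp
    then have "b = - grad (peval f) 0 + (\<Sum>j\<in>active m g 0. \<theta> j *\<^sub>R grad (peval (con g j)) 0)"
      unfolding grad_q .
    with \<theta> show ?thesis by (intro exI[of _ \<theta>] conjI)
  qed
  show ?thesis
    using linear inv_opt coefs nonneg sdp_opt val multipliers
    by (intro exI[of _ b] exI[of _ lam] conjI impI allI) simp_all
qed

end
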